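(* Let $A,B\in M_2(\mathbb{Z})$ be expanding matrices with characteristic polynomials $x^2+px+q$ and $x^2-px+q$ respectively ($p,q\in\mathbb{Z}$). Let $v,w\in\mathbb{R}^2$ be nonzero vectors such that $\{v,Av\}$ and $\{w,Bw\}$ are each linearly independent. Let $c_i,d_i\in\mathbb{Z}$ for $i=0,1,\dots,|q|-1$ be such that the points $c_iAv+d_iv$ are pairwise distinct, and put $\mathcal{D}=\{c_iAv+d_iv: i=0,\dots,|q|-1\}$ and $\mathcal{D}'=\{-c_iBw+d_iw: i=0,\dots,|q|-1\}$. Then $T(A,\mathcal{D})$ is connected if and only if $T(B,\mathcal{D}')$ is connected.
   Context: A real square matrix is expanding if all its eigenvalues have modulus strictly larger than $1$. For an expanding matrix $A\in M_n(\mathbb{Z})$ and a finite set $\mathcal{D}\subset\mathbb{R}^n$ with $|\mathcal D|=|\det A|$, the self-affine set $T(A,\mathcal{D})$ is the unique nonempty compact set $T$ with $AT=T+\mathcal{D}$; equivalently $T=\{\sum_{i=1}^\infty A^{-i}d_{j_i}: d_{j_i}\in\mathcal{D}\}$. *)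

theory Defs
  imports "HOL-Analysis.Analysis"
begin

text \<open>Integer matrix: all entries are integers.\<close>
definition int_matrix :: "real^'n^'n \<Rightarrow> bool" where
  "int_matrix A \<longleftrightarrow> (\<forall>i j. A $ i $ j \<in> \<int>)"

text \<open>Complexification of a real matrix.\<close>
definition cmat :: "real^'n^'n \<Rightarrow> complex^'n^'n" where
  "cmat A = (\<chi> i j. complex_of_real (A $ i $ j))"

text \<open>Expanding: every (complex) eigenvalue, i.e. every root of the characteristic
  polynomial det(zI - A), has modulus strictly larger than 1.\<close>
definition expanding :: "real^'n^'n \<Rightarrow> bool" where
  "expanding A \<longleftrightarrow> (\<forall>z::complex. det (mat z - cmat A) = 0 \<longrightarrow> cmod z > 1)"

text \<open>The self-affine set T(A,D) = { sum_{i>=1} A^{-i} d_i : d_i in D }.\<close>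
definition self_affine :: "real^'n^'n \<Rightarrow> (real^'n) set \<Rightarrow> (real^'n) set" where
  "self_affine A D = {x. \<exists>d::nat \<Rightarrow> real^'n. (\<forall>i. d i \<in> D) \<and>
      (\<lambda>i. (((*v) (matrix_inv A)) ^^ (Suc i)) (d i)) sums x}"

end

theory Submission
  imports Defs
begin

(* Connectedness of the self-affine tiles T(A, D) and T(B, D').

   Write T(f, D) for the attractor of the linear iterated function system
   x |-> f (x + a), a in D, so that T(A, D) = T(A^-1, D).  The proof has three parts.

   1. Hata's criterion (locale contractive_ifs): for a linear injective f whose
      iterates are summably small, T(f, D) is connected iff the graph on D with an
      edge a -> a' whenever a' - a lies in T - T is connected.  Replacing f by -f
      leaves T - T unchanged (swap the digits of two expansions at every other
      position), so T(f, D) and T(-f, D) are connected or not together.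
   2. Expanding 2 x 2 matrices: the eigenvalues of M^-1 lie in the open unit disc,
      and by Cayley-Hamilton the iterates M^-n decay like (n + 1) rho^n with rho < 1,
      so M^-1 meets the hypotheses of part 1.
   3. A and -B have the same characteristic polynomial, so the linear map L with
      L v = w and L (A v) = -B w satisfies L A = -B L.  It maps D onto D' and
      carries T(A^-1, D) homeomorphically onto T(-B^-1, D'); part 1 relates the
      latter to T(B^-1, D'). *)

text \<open>Attractor of the linear iterated function system \<open>x \<mapsto> f (x + a)\<close>, \<open>a \<in> D\<close>: the
  sums \<open>\<Sum>\<^sub>k f\<^sup>k\<^sup>+\<^sup>1 (d k)\<close> over all digit sequences \<open>d\<close> in \<open>D\<close>.\<close>

definition attractor :: "('a::real_normed_vector \<Rightarrow> 'a) \<Rightarrow> 'a set \<Rightarrow> 'a set" where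
  "attractor f D = {x. \<exists>d. (\<forall>k. d k \<in> D) \<and> (\<lambda>k. (f ^^ Suc k) (d k)) sums x}"

text \<open>The self-affine set \<open>T(M, D)\<close> is the attractor of \<open>M\<^sup>-\<^sup>1\<close>.\<close>

lemma self_affine_eq_attractor: "self_affine A D = attractor ((*v) (matrix_inv A)) D"
  unfolding self_affine_def attractor_def by simp

text \<open>A map intertwining \<open>f\<close> and \<open>g\<close> intertwines their iterates.\<close>

lemma funpow_commute:
  assumes "\<And>z. L (f z) = g (L z)"
  shows "L ((f ^^ n) z) = (g ^^ n) (L z)"
  by (induction n) (simp_all add: assms)

text \<open>A linear map intertwining \<open>f\<close> and \<open>g\<close> carries digit expansions for \<open>f\<close> to digit
  expansions for \<open>g\<close>.\<close>

lemma attractor_linear_image: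
  fixes L :: "'a::euclidean_space \<Rightarrow> 'b::euclidean_space"
  assumes "linear L" and "\<And>z. L (f z) = g (L z)"
  shows "L ` attractor f D \<subseteq> attractor g (L ` D)"
proof
  fix y assume "y \<in> L ` attractor f D"
  then obtain x d where y: "y = L x" and d: "\<forall>k. d k \<in> D" "(\<lambda>k. (f ^^ Suc k) (d k)) sums x"
    unfolding attractor_def by blast
  have "bounded_linear L" using assms(1) linear_conv_bounded_linear by blast
  from bounded_linear.sums[OF this d(2)]
  have "(\<lambda>k. (g ^^ Suc k) (L (d k))) sums y"
    unfolding y funpow_commute[of L f g, OF assms(2)] .
  then show "y \<in> attractor g (L ` D)"
    unfolding attractor_def using d(1) by (intro CollectI exI[of _ "\<lambda>k. L (d k)"]) auto
qed

text \<open>Linearly conjugate systems have homeomorphic attractors, so connectedness transfers.\<close>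

lemma connected_attractor_conjugate:
  fixes L L' :: "'a::euclidean_space \<Rightarrow> 'a"
  assumes "linear L" "linear L'" "\<And>z. L' (L z) = z" "\<And>z. L (L' z) = z"
    and conj: "\<And>z. L (f z) = g (L z)"
  shows "connected (attractor f D) \<longleftrightarrow> connected (attractor g (L ` D))"
proof -
  have conj': "L' (g z) = f (L' z)" for z
    by (metis assms(3,4) conj)
  have "L' ` L ` D = D" by (simp add: image_image assms(3))
  then have "L' ` attractor g (L ` D) \<subseteq> attractor f D"
    using attractor_linear_image[of L' g f "L ` D", OF assms(2) conj'] by simp
  then have "attractor g (L ` D) \<subseteq> L ` attractor f D"
  proof (intro subsetI)
    fix x assume "x \<in> attractor g (L ` D)"
    then have "L' x \<in> attractor f D" using \<open>L' ` _ \<subseteq> _\<close> by blast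
    then show "x \<in> L ` attractor f D" using assms(4)[of x] by (metis image_eqI)
  qed
  then have image_eq: "attractor g (L ` D) = L ` attractor f D"
    using attractor_linear_image[of L f g D, OF assms(1) conj] by blast
  have "continuous_on UNIV L" "continuous_on UNIV L'"
    using assms(1,2) linear_continuous_on linear_conv_bounded_linear by blast+
  show ?thesis
  proof
    assume "connected (attractor f D)"
    then show "connected (attractor g (L ` D))"
      unfolding image_eq
      by (meson connected_continuous_image continuous_on_subset subset_UNIV \<open>continuous_on UNIV L\<close>)
  next
    assume "connected (attractor g (L ` D))"
    then have "connected (L' ` attractor g (L ` D))"
      by (meson connected_continuous_image continuous_on_subset subset_UNIV \<open>continuous_on UNIV L'\<close>)
    moreover have "L' ` attractor g (L ` D) = attractor f D"
      unfolding image_eq image_image assms(3) by simp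
    ultimately show "connected (attractor f D)" by simp
  qed
qed

text \<open>A compact set in which any two points can be joined by an \<open>\<epsilon>\<close>-chain, for every
  \<open>\<epsilon> > 0\<close>, is connected: a separation into two closed pieces would have positive
  distance, which no sufficiently fine chain can jump.\<close>

definition fine_steps :: "'a::metric_space set \<Rightarrow> real \<Rightarrow> ('a \<times> 'a) set" where
  "fine_steps S \<epsilon> = {(x, y). x \<in> S \<and> y \<in> S \<and> dist x y < \<epsilon>}"

lemma compact_chainable_connected:
  fixes S :: "'a::euclidean_space set"
  assumes "compact S"
    and chains: "\<And>\<epsilon> x y. \<epsilon> > 0 \<Longrightarrow> x \<in> S \<Longrightarrow> y \<in> S \<Longrightarrow> (x, y) \<in> (fine_steps S \<epsilon>)\<^sup>*"
  shows "connected S"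
proof (rule ccontr)
  assume "\<not> connected S"
  then obtain U V where UV: "closed U" "closed V" "S \<subseteq> U \<union> V" "U \<inter> V \<inter> S = {}"
    "U \<inter> S \<noteq> {}" "V \<inter> S \<noteq> {}"
    unfolding connected_closed by blast
  define \<delta> where "\<delta> = setdist (U \<inter> S) (V \<inter> S)"
  have "compact (U \<inter> S)" "closed (V \<inter> S)"
    using assms(1) UV(1,2) by (auto simp: compact_Int_closed Int_commute compact_imp_closed closed_Int)
  then have "\<delta> > 0"
    unfolding \<delta>_def using UV(4-6) setdist_gt_0_compact_closed by blast
  have stays: "y \<in> U \<inter> S" if "(x, y) \<in> (fine_steps S \<delta>)\<^sup>*" "x \<in> U \<inter> S" for x y
    using that
  proof (induction rule: rtrancl_induct)
    case (step y z)
    then have "y \<in> U \<inter> S" "z \<in> S" "dist y z < \<delta>" by (auto simp: fine_steps_def)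
    moreover have "\<delta> \<le> dist y z" if "z \<in> V \<inter> S"
      unfolding \<delta>_def using \<open>y \<in> U \<inter> S\<close> that by (rule setdist_le_dist)
    ultimately show ?case using UV(3) by fastforce
  qed
  obtain x y where "x \<in> U \<inter> S" "y \<in> V \<inter> S" using UV(5,6) by blast
  then have "y \<in> U \<inter> S" using stays chains[OF \<open>\<delta> > 0\<close>] by blast
  then show False using \<open>y \<in> V \<inter> S\<close> UV(4) by blast
qed

text \<open>Iterates of linear maps and of their negatives.\<close>

lemma linear_funpow:
  fixes f :: "'a::real_vector \<Rightarrow> 'a"
  shows "linear f \<Longrightarrow> linear (f ^^ n)"
proof (induction n)
  case (Suc n)
  then show ?case using linear_compose[of "f ^^ n" f] by (simp add: o_def)
qed (simp add: linear_id)

lemma funpow_neg_linear: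
  fixes f :: "'a::real_vector \<Rightarrow> 'a"
  assumes "linear f"
  shows "((\<lambda>z. - f z) ^^ n) z = (-1) ^ n *\<^sub>R (f ^^ n) z"
proof (induction n)
  case (Suc n)
  have "((\<lambda>z. - f z) ^^ Suc n) z = - f ((-1) ^ n *\<^sub>R (f ^^ n) z)" using Suc by simp
  also have "\<dots> = (-1) ^ Suc n *\<^sub>R (f ^^ Suc n) z" by (simp add: linear_scale[OF assms])
  finally show ?case .
qed simp

text \<open>A linear injective map \<open>f\<close> whose iterates are bounded by a summable sequence, with a
  finite nonempty digit set \<open>D\<close>.  The maps of the system are \<open>branch a\<close>, and the Hata
  graph links two digits when their pieces \<open>branch a ` T\<close> can intersect.\<close>

locale contractive_ifs =
  fixes f :: "'a::euclidean_space \<Rightarrow> 'a" and bound :: "nat \<Rightarrow> real" and D :: "'a set"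
  assumes f_linear: "linear f" and f_inj: "inj f"
    and bound_summable: "summable bound" and bound_nonneg: "\<And>n. bound n \<ge> 0"
    and iterate_bound: "\<And>n x. norm ((f ^^ n) x) \<le> bound n * norm x"
    and digits_finite: "finite D" and digits_nonempty: "D \<noteq> {}"
begin

abbreviation T :: "'a set" where "T \<equiv> attractor f D"

definition branch :: "'a \<Rightarrow> 'a \<Rightarrow> 'a" where "branch a x = f (x + a)"

definition difference_set :: "'a set" where
  "difference_set = {x - y | x y. x \<in> T \<and> y \<in> T}"

definition hata_graph :: "('a \<times> 'a) set" where
  "hata_graph = {(a, a'). a \<in> D \<and> a' \<in> D \<and> a' - a \<in> difference_set}"

lemma f_bounded_linear: "bounded_linear f"
  using f_linear linear_conv_bounded_linear by blast

text \<open>Every digit series converges: its \<open>k\<close>-th term is bounded by \<open>bound (k + 1) \<cdot> R\<close>,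
  where \<open>R\<close> bounds the norms of the digits.\<close>

lemma digits_bounded: obtains R where "R \<ge> 0" "\<And>a. a \<in> D \<Longrightarrow> norm a \<le> R"
proof -
  obtain R where "\<And>a. a \<in> D \<Longrightarrow> norm a \<le> R"
    using finite_imp_bounded[OF digits_finite] by (auto simp: bounded_iff)
  then show ?thesis by (intro that[of "max R 0"]) (auto intro: order_trans[OF _ max.cobounded1])
qed

lemma digit_term_bound:
  assumes "\<And>a. a \<in> D \<Longrightarrow> norm a \<le> R" "a \<in> D"
  shows "norm ((f ^^ n) a) \<le> bound n * R"
proof -
  have "norm ((f ^^ n) a) \<le> bound n * norm a" by (rule iterate_bound)
  also have "\<dots> \<le> bound n * R" using assms bound_nonneg by (simp add: mult_left_mono)
  finally show ?thesis .
qed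

lemma shifted_bound_summable: "summable (\<lambda>k. bound (Suc k) * R)"
  using bound_summable by (simp add: summable_Suc_iff summable_mult2)

lemma digit_series_summable:
  assumes "\<forall>k. d k \<in> D" shows "summable (\<lambda>k. (f ^^ Suc k) (d k))"
proof -
  obtain R where R: "\<And>a. a \<in> D \<Longrightarrow> norm a \<le> R" using digits_bounded by blast
  show ?thesis
  proof (rule summable_comparison_test')
    show "norm ((f ^^ Suc k) (d k)) \<le> bound (Suc k) * R" for k
      using digit_term_bound[OF R] assms by blast
  qed (rule shifted_bound_summable)
qed

text \<open>Prepending a digit: if \<open>x\<close> has digit expansion \<open>d\<close>, then \<open>f (x + a)\<close> has expansion
  \<open>a, d 0, d 1, \<dots>\<close>.\<close>

lemma sums_prepend_digit:
  assumes "(\<lambda>k. (f ^^ Suc k) (d k)) sums x"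
  shows "(\<lambda>k. (f ^^ Suc k) (case_nat a d k)) sums branch a x"
proof -
  have "(\<lambda>k. f ((f ^^ Suc k) (d k))) sums f x"
    by (rule bounded_linear.sums[OF f_bounded_linear assms])
  then have "(\<lambda>k. (f ^^ Suc (Suc k)) (case_nat a d (Suc k))) sums f x"
    by (simp add: funpow_swap1)
  then show ?thesis
    by (subst (asm) sums_Suc_iff) (simp add: branch_def linear_add[OF f_linear])
qed

text \<open>The self-similarity \<open>T = (\<Union>a\<in>D. branch a ` T)\<close>, in both directions.\<close>

lemma branch_in_attractor: assumes "a \<in> D" "x \<in> T" shows "branch a x \<in> T"
proof -
  obtain d where d: "\<forall>k. d k \<in> D" "(\<lambda>k. (f ^^ Suc k) (d k)) sums x"
    using assms(2) unfolding attractor_def by blast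
  have "\<forall>k. case_nat a d k \<in> D" using d(1) assms(1) by (simp split: nat.split)
  then show ?thesis
    using sums_prepend_digit[OF d(2)] unfolding attractor_def by blast
qed

lemma attractor_decomposition: assumes "x \<in> T" shows "\<exists>a\<in>D. \<exists>x'\<in>T. x = branch a x'"
proof -
  obtain d where d: "\<forall>k. d k \<in> D" "(\<lambda>k. (f ^^ Suc k) (d k)) sums x"
    using assms unfolding attractor_def by blast
  obtain x' where x': "(\<lambda>k. (f ^^ Suc k) (d (Suc k))) sums x'"
    using digit_series_summable[of "\<lambda>k. d (Suc k)"] d(1) by (auto simp: summable_def)
  then have "x' \<in> T" using d(1) unfolding attractor_def
    by (intro CollectI exI[of _ "\<lambda>k. d (Suc k)"]) simp
  have "case_nat (d 0) (\<lambda>k. d (Suc k)) = d" by (rule ext) (simp split: nat.split)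
  then have "(\<lambda>k. (f ^^ Suc k) (d k)) sums branch (d 0) x'"
    using sums_prepend_digit[OF x', of "d 0"] by simp
  then have "x = branch (d 0) x'" using d(2) sums_unique2 by blast
  then show ?thesis using \<open>x' \<in> T\<close> d(1) by blast
qed

text \<open>\<open>T\<close> is nonempty and bounded.\<close>

lemma attractor_nonempty: "T \<noteq> {}"
proof -
  obtain a where a: "a \<in> D" using digits_nonempty by blast
  then obtain x where "(\<lambda>k. (f ^^ Suc k) a) sums x"
    using digit_series_summable[of "\<lambda>_. a"] by (auto simp: summable_def)
  then have "x \<in> T" using a unfolding attractor_def by (intro CollectI exI[of _ "\<lambda>_. a"]) simp
  then show ?thesis by blast
qed

lemma attractor_bounded: obtains R where "R \<ge> 0" "\<And>x. x \<in> T \<Longrightarrow> norm x \<le> R"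
proof -
  obtain R where R: "R \<ge> 0" "\<And>a. a \<in> D \<Longrightarrow> norm a \<le> R" using digits_bounded by blast
  note s = shifted_bound_summable[of R]
  have "norm x \<le> (\<Sum>k. bound (Suc k) * R)" if x: "x \<in> T" for x
  proof -
    obtain d where d: "\<forall>k. d k \<in> D" "(\<lambda>k. (f ^^ Suc k) (d k)) sums x"
      using x unfolding attractor_def by blast
    have "norm ((f ^^ Suc k) (d k)) \<le> bound (Suc k) * R" for k
      using digit_term_bound[OF R(2)] d(1) by blast
    then have "norm (\<Sum>k. (f ^^ Suc k) (d k)) \<le> (\<Sum>k. bound (Suc k) * R)"
      by (rule norm_suminf_le[OF _ s])
    then show ?thesis using d(2) sums_unique by metis
  qed
  moreover have "(\<Sum>k. bound (Suc k) * R) \<ge> 0"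
    using s bound_nonneg R(1) by (intro suminf_nonneg) auto
  ultimately show ?thesis by (rule that[rotated])
qed

text \<open>The attractor is the image of the compact space of digit sequences under the
  uniformly convergent, hence continuous, series map.\<close>

lemma attractor_compact: "compact T"
proof -
  define S where "S = PiE UNIV (\<lambda>_::nat. D)"
  define series where "series d = (\<Sum>k. (f ^^ Suc k) (d k))" for d
  have "T = series ` S"
    unfolding attractor_def S_def series_def
    using digit_series_summable sums_unique by (fastforce simp: PiE_UNIV_domain summable_sums)
  have "compactin (product_topology (\<lambda>_. euclidean) UNIV) S"
    unfolding S_def compactin_PiE using digits_finite by (auto intro: finite_imp_compact)
  then have "compact S" by (simp add: euclidean_product_topology)
  obtain R where R: "\<And>a. a \<in> D \<Longrightarrow> norm a \<le> R" using digits_bounded by blast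
  have "uniform_limit S (\<lambda>n d. \<Sum>k<n. (f ^^ Suc k) (d k)) series sequentially"
    unfolding series_def
  proof (rule Weierstrass_m_test[OF _ shifted_bound_summable])
    show "norm ((f ^^ Suc k) (d k)) \<le> bound (Suc k) * R" if "d \<in> S" for k d
      by (rule digit_term_bound[OF R]) (use that in \<open>auto simp: S_def PiE_UNIV_domain\<close>)
  qed
  moreover have "continuous_on S (\<lambda>d. \<Sum>k<n. (f ^^ Suc k) (d k))" for n
  proof (intro continuous_on_sum)
    fix k
    have "bounded_linear (f ^^ Suc k)"
      using linear_funpow[OF f_linear] linear_conv_bounded_linear by blast
    from linear_continuous_on[OF this]
    show "continuous_on S (\<lambda>d. (f ^^ Suc k) (d k))"
      by (rule continuous_on_compose2[of UNIV _ S "\<lambda>d. d k"])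
        (auto intro: continuous_on_subset[OF continuous_on_product_coordinates])
  qed
  ultimately have "continuous_on S series"
    by (intro uniform_limit_theorem) auto
  then show ?thesis using \<open>T = series ` S\<close> \<open>compact S\<close> compact_continuous_image by metis
qed

text \<open>Each piece \<open>branch a ` T\<close> is compact, being a continuous image of \<open>T\<close>.\<close>

lemma branch_compact: "compact (branch a ` T)"
proof -
  have "continuous_on T (\<lambda>x. f (x + a))"
    by (intro continuous_on_compose2[OF linear_continuous_on[OF f_bounded_linear], of T _ UNIV])
      (auto intro: continuous_intros)
  then show ?thesis
    unfolding branch_def using attractor_compact compact_continuous_image by blast
qed

text \<open>Necessity in Hata's criterion: the pieces \<open>branch a ` T\<close> belonging to digits
  reachable from \<open>a\<^sub>0\<close> in the Hata graph are disjoint from the remaining pieces, because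
  \<open>branch a x = branch a' x'\<close> means \<open>a' - a = x - x' \<in> difference_set\<close>. Both unions
  are closed, so a connected \<open>T\<close> forces every digit to be reachable.\<close>

lemma connected_imp_hata_graph_connected:
  assumes "connected T" "a\<^sub>0 \<in> D" "a\<^sub>1 \<in> D" shows "(a\<^sub>0, a\<^sub>1) \<in> hata_graph\<^sup>*"
proof (rule ccontr)
  assume unreachable: "(a\<^sub>0, a\<^sub>1) \<notin> hata_graph\<^sup>*"
  define P where "P = {a\<in>D. (a\<^sub>0, a) \<in> hata_graph\<^sup>*}"
  define U where "U = (\<Union>a\<in>P. branch a ` T)"
  define V where "V = (\<Union>a\<in>D-P. branch a ` T)"
  have "finite P" "finite (D - P)" using digits_finite by (auto simp: P_def)
  then have "closed U" "closed V"
    unfolding U_def V_def by (auto intro!: closed_UN compact_imp_closed branch_compact)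
  have "T \<subseteq> U \<union> V"
  proof
    fix x assume "x \<in> T"
    then obtain a x' where "a \<in> D" "x' \<in> T" "x = branch a x'" using attractor_decomposition by blast
    then show "x \<in> U \<union> V" unfolding U_def V_def by (cases "a \<in> P") auto
  qed
  have "U \<inter> V = {}"
  proof (rule ccontr)
    assume "U \<inter> V \<noteq> {}"
    then obtain a a' x x' where aa': "a \<in> P" "a' \<in> D - P" "x \<in> T" "x' \<in> T"
      "branch a x = branch a' x'"
      unfolding U_def V_def by blast
    then have "x + a = x' + a'" using f_inj unfolding branch_def inj_def by blast
    then have "a' - a = x - x'" by (simp add: algebra_simps)
    then have "(a, a') \<in> hata_graph"
      using aa' unfolding hata_graph_def difference_set_def P_def by blast
    then have "a' \<in> P" using aa'(1,2) unfolding P_def by (auto intro: rtrancl_into_rtrancl)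
    then show False using aa'(2) by blast
  qed
  obtain t where "t \<in> T" using attractor_nonempty by blast
  have "a\<^sub>0 \<in> P" "a\<^sub>1 \<in> D - P" using assms(2,3) unreachable unfolding P_def by auto
  then have "branch a\<^sub>0 t \<in> U \<inter> T" "branch a\<^sub>1 t \<in> V \<inter> T"
    using \<open>t \<in> T\<close> assms(2,3) branch_in_attractor unfolding U_def V_def by auto
  then have "U \<inter> T \<noteq> {}" "V \<inter> T \<noteq> {}" "U \<inter> V \<inter> T = {}" using \<open>U \<inter> V = {}\<close> by auto
  then show False
    using assms(1) \<open>closed U\<close> \<open>closed V\<close> \<open>T \<subseteq> U \<union> V\<close>
    unfolding connected_closed by meson
qed

text \<open>Steps inside \<open>T\<close> whose displacement lies in the \<open>n\<close>-th image of the difference set;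
  these become arbitrarily short as \<open>n\<close> grows.\<close>

definition refined_steps :: "nat \<Rightarrow> ('a \<times> 'a) set" where
  "refined_steps n = {(x, y). x \<in> T \<and> y \<in> T \<and> y - x \<in> (f ^^ n) ` difference_set}"

text \<open>Applying a branch turns a chain of \<open>n\<close>-refined steps into one of \<open>(n + 1)\<close>-refined steps.\<close>

lemma branch_refined_steps:
  assumes "a \<in> D" "(x, y) \<in> (refined_steps n)\<^sup>*"
  shows "(branch a x, branch a y) \<in> (refined_steps (Suc n))\<^sup>*"
  using assms(2)
proof (induction rule: rtrancl_induct)
  case (step y z)
  then obtain u where u: "y \<in> T" "z \<in> T" "u \<in> difference_set" "z - y = (f ^^ n) u"
    unfolding refined_steps_def by auto
  have "branch a z - branch a y = f (z - y)"
    unfolding branch_def by (simp add: linear_diff[OF f_linear, symmetric])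
  then have "(branch a y, branch a z) \<in> refined_steps (Suc n)"
    using u assms(1) branch_in_attractor unfolding refined_steps_def by (auto simp: image_iff)
  then show ?case using step.IH by (rule rtrancl_into_rtrancl[rotated])
qed simp

text \<open>If the Hata graph is connected, any two points of \<open>T\<close> are linked by a chain of
  \<open>n\<close>-refined steps, for every \<open>n\<close>: decompose both points by their first digits and
  walk along a path of the Hata graph; consecutive digits \<open>a, a'\<close> on the path give
  pieces that meet, because \<open>a' - a = x - x'\<close> yields \<open>branch a x = branch a' x'\<close>.\<close>

lemma hata_graph_connected_imp_chains:
  assumes graph_connected: "\<And>a a'. a \<in> D \<Longrightarrow> a' \<in> D \<Longrightarrow> (a, a') \<in> hata_graph\<^sup>*"
  shows "x \<in> T \<Longrightarrow> y \<in> T \<Longrightarrow> (x, y) \<in> (refined_steps n)\<^sup>*"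
proof (induction n arbitrary: x y)
  case 0
  then show ?case unfolding refined_steps_def difference_set_def by auto
next
  case (Suc n)
  have along_path: "(branch a x', branch a' y') \<in> (refined_steps (Suc n))\<^sup>*"
    if "(a, a') \<in> hata_graph\<^sup>*" "a \<in> D" "x' \<in> T" "y' \<in> T" for a a' x' y'
    using that(1,4)
  proof (induction arbitrary: y' rule: rtrancl_induct)
    case base
    then show ?case using branch_refined_steps[OF that(2) Suc.IH[OF that(3)]] by simp
  next
    case (step a' a'')
    then obtain u u' where uu': "u \<in> T" "u' \<in> T" "a'' - a' = u - u'" "a'' \<in> D"
      unfolding hata_graph_def difference_set_def by auto
    then have "branch a' u = branch a'' u'"
      unfolding branch_def by (simp add: algebra_simps)
    moreover have "(branch a x', branch a' u) \<in> (refined_steps (Suc n))\<^sup>*"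
      using step.IH uu'(1) .
    moreover have "(branch a'' u', branch a'' y') \<in> (refined_steps (Suc n))\<^sup>*"
      using branch_refined_steps[OF uu'(4) Suc.IH[OF uu'(2) step.prems]] .
    ultimately show ?case by (metis rtrancl_trans)
  qed
  obtain a x' b y' where "a \<in> D" "x' \<in> T" "x = branch a x'" "b \<in> D" "y' \<in> T" "y = branch b y'"
    using attractor_decomposition Suc.prems by metis
  then show ?case using along_path graph_connected by simp
qed

text \<open>Refined steps have length at most \<open>bound n \<cdot> diam T\<close>, which tends to \<open>0\<close>.\<close>

lemma refined_steps_eventually_fine:
  assumes "\<epsilon> > 0" obtains n where "refined_steps n \<subseteq> fine_steps T \<epsilon>"
proof -
  obtain R where R: "R \<ge> 0" "\<And>x. x \<in> T \<Longrightarrow> norm x \<le> R" using attractor_bounded by blast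
  have "(\<lambda>n. bound n * (2 * R)) \<longlonglongrightarrow> 0 * (2 * R)"
    using summable_LIMSEQ_zero[OF bound_summable] by (intro tendsto_intros)
  then have "eventually (\<lambda>n. bound n * (2 * R) < \<epsilon>) sequentially"
    using assms by (intro order_tendstoD(2)) auto
  then obtain n where n: "bound n * (2 * R) < \<epsilon>"
    by (meson eventually_sequentially order.refl)
  have "dist x y < \<epsilon>" if step: "(x, y) \<in> refined_steps n" for x y
  proof -
    obtain u u' where u: "u \<in> T" "u' \<in> T" "y - x = (f ^^ n) (u - u')"
      using step unfolding refined_steps_def difference_set_def by auto
    have "norm (u - u') \<le> 2 * R"
      using R(2)[OF u(1)] R(2)[OF u(2)] norm_triangle_ineq4[of u u'] by linarith
    then have "norm ((f ^^ n) (u - u')) \<le> bound n * (2 * R)"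
      using iterate_bound[of n "u - u'"] bound_nonneg[of n] mult_left_mono order_trans by blast
    then have "norm (y - x) < \<epsilon>" using u(3) n by simp
    then show ?thesis by (simp add: dist_norm norm_minus_commute)
  qed
  then show ?thesis
    by (intro that[of n]) (auto simp: fine_steps_def refined_steps_def)
qed

text \<open>Sufficiency in Hata's criterion: \<open>T\<close> is chainable at every scale, hence connected.\<close>

lemma hata_graph_connected_imp_connected:
  assumes "\<And>a a'. a \<in> D \<Longrightarrow> a' \<in> D \<Longrightarrow> (a, a') \<in> hata_graph\<^sup>*"
  shows "connected T"
proof (rule compact_chainable_connected[OF attractor_compact])
  fix \<epsilon> :: real and x y assume "\<epsilon> > 0" "x \<in> T" "y \<in> T"
  obtain n where "refined_steps n \<subseteq> fine_steps T \<epsilon>"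
    using refined_steps_eventually_fine[OF \<open>\<epsilon> > 0\<close>] .
  then show "(x, y) \<in> (fine_steps T \<epsilon>)\<^sup>*"
    using hata_graph_connected_imp_chains[OF assms \<open>x \<in> T\<close> \<open>y \<in> T\<close>, of n] rtrancl_mono by blast
qed

text \<open>Hata's criterion: the attractor is connected iff its Hata graph is connected.\<close>

theorem hata_criterion: "connected T \<longleftrightarrow> (\<forall>a\<in>D. \<forall>a'\<in>D. (a, a') \<in> hata_graph\<^sup>*)"
  using connected_imp_hata_graph_connected hata_graph_connected_imp_connected by blast

text \<open>The system of \<open>-f\<close> satisfies the same hypotheses with the same bounds.\<close>

lemma neg_contractive_ifs: "contractive_ifs (\<lambda>z. - f z) bound D"
proof (rule contractive_ifs.intro)
  show "linear (\<lambda>z. - f z)" using f_linear by (simp add: linear_compose_neg)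
  show "inj (\<lambda>z. - f z)" using f_inj by (simp add: inj_def)
  show "norm (((\<lambda>z. - f z) ^^ n) x) \<le> bound n * norm x" for n x
    using iterate_bound[of n x] by (simp add: funpow_neg_linear[OF f_linear])
qed (use bound_summable bound_nonneg digits_finite digits_nonempty in auto)

text \<open>Reversing the sign of \<open>f\<close> does not change the difference set: in a difference of two
  expansions for \<open>-f\<close>, swap the digits of the two expansions at every odd position.\<close>

lemma neg_difference_subset:
  "{x - y | x y. x \<in> attractor (\<lambda>z. - f z) D \<and> y \<in> attractor (\<lambda>z. - f z) D} \<subseteq> difference_set"
proof
  fix z assume "z \<in> {x - y | x y. x \<in> attractor (\<lambda>z. - f z) D \<and> y \<in> attractor (\<lambda>z. - f z) D}"
  then obtain x y d e where z: "z = x - y" and de: "\<forall>k. d k \<in> D" "\<forall>k. e k \<in> D"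
    and x: "(\<lambda>k. ((\<lambda>z. - f z) ^^ Suc k) (d k)) sums x"
    and y: "(\<lambda>k. ((\<lambda>z. - f z) ^^ Suc k) (e k)) sums y"
    unfolding attractor_def by blast
  define d' where "d' k = (if even k then e k else d k)" for k
  define e' where "e' k = (if even k then d k else e k)" for k
  have "\<forall>k. d' k \<in> D" "\<forall>k. e' k \<in> D" using de by (simp_all add: d'_def e'_def)
  then obtain x' y' where x': "(\<lambda>k. (f ^^ Suc k) (d' k)) sums x'"
    and y': "(\<lambda>k. (f ^^ Suc k) (e' k)) sums y'"
    using digit_series_summable by (meson summable_sums)
  have "(\<lambda>k. ((\<lambda>z. - f z) ^^ Suc k) (d k) - ((\<lambda>z. - f z) ^^ Suc k) (e k))
      = (\<lambda>k. (f ^^ Suc k) (d' k) - (f ^^ Suc k) (e' k))"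
    by (rule ext) (simp add: funpow_neg_linear[OF f_linear] d'_def e'_def linear_neg[OF f_linear])
  then have "z = x' - y'"
    using sums_diff[OF x y] sums_diff[OF x' y'] z sums_unique2 by metis
  moreover have "x' \<in> T" "y' \<in> T"
    using x' y' \<open>\<forall>k. d' k \<in> D\<close> \<open>\<forall>k. e' k \<in> D\<close> unfolding attractor_def by blast+
  ultimately show "z \<in> difference_set" unfolding difference_set_def by blast
qed

text \<open>Consequently \<open>f\<close> and \<open>-f\<close> have the same Hata graph, and by Hata's criterion their
  attractors are connected or disconnected together.\<close>

theorem connected_attractor_neg: "connected (attractor (\<lambda>z. - f z) D) \<longleftrightarrow> connected T"
proof -
  interpret neg: contractive_ifs "\<lambda>z. - f z" bound D by (rule neg_contractive_ifs)
  have "neg.difference_set \<subseteq> difference_set"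
    unfolding neg.difference_set_def by (rule neg_difference_subset)
  moreover have "difference_set \<subseteq> neg.difference_set"
    using neg.neg_difference_subset unfolding difference_set_def by simp
  ultimately have "neg.hata_graph = hata_graph"
    unfolding neg.hata_graph_def hata_graph_def by simp
  then show ?thesis using neg.hata_criterion hata_criterion by simp
qed

end

text \<open>Basic facts on matrices: inverses, and the characteristic polynomial and
  Cayley-Hamilton theorem in dimension \<open>2\<close>.\<close>

lemma matrix_inv_mult:
  fixes M :: "real^'n^'n" assumes "invertible M"
  shows "M *v (matrix_inv M *v z) = z" "matrix_inv M *v (M *v z) = z"
proof -
  have "M ** matrix_inv M = mat 1" "matrix_inv M ** M = mat 1"
    using someI_ex[OF assms[unfolded invertible_def]] unfolding matrix_inv_def by auto
  then show "M *v (matrix_inv M *v z) = z" "matrix_inv M *v (M *v z) = z"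
    by (metis matrix_vector_mul_assoc matrix_vector_mul_lid)+
qed

lemma char_poly_2:
  fixes M :: "real^2^2"
  shows "det (mat z - cmat M) = z\<^sup>2 - complex_of_real (M$1$1 + M$2$2) * z + complex_of_real (det M)"
  by (simp add: det_2 cmat_def mat_def power2_eq_square algebra_simps)

lemma cayley_hamilton_2:
  fixes M :: "real^2^2"
  shows "M *v (M *v z) = (M$1$1 + M$2$2) *\<^sub>R (M *v z) - det M *\<^sub>R z"
  by (simp add: vec_eq_iff forall_2 det_2 matrix_vector_mult_def sum_2 algebra_simps)

text \<open>Expanding matrices are invertible, since \<open>0\<close> is not an eigenvalue.\<close>

lemma expanding_det_nonzero:
  fixes M :: "real^2^2" assumes "expanding M" shows "det M \<noteq> 0"
proof
  assume "det M = 0"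
  then have "det (mat 0 - cmat M) = 0" using char_poly_2[of 0 M] by simp
  then show False using assms unfolding expanding_def by fastforce
qed

text \<open>The eigenvalues of \<open>M\<^sup>-\<^sup>1\<close> are the reciprocals \<open>\<mu>\<^sub>1, \<mu>\<^sub>2\<close> of the roots of the
  characteristic polynomial; they lie in the open unit disc.\<close>

lemma expanding_inverse_eigenvalues:
  fixes M :: "real^2^2"
  assumes "expanding M"
  obtains \<mu>1 \<mu>2 :: complex where "cmod \<mu>1 < 1" "cmod \<mu>2 < 1" "\<mu>1 \<noteq> 0" "\<mu>2 \<noteq> 0"
    "\<mu>1 + \<mu>2 = complex_of_real ((M$1$1 + M$2$2) / det M)"
    "\<mu>1 * \<mu>2 = complex_of_real (1 / det M)"
proof -
  define t where "t = complex_of_real (M$1$1 + M$2$2)"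
  define \<delta> where "\<delta> = complex_of_real (det M)"
  define s where "s = csqrt (t\<^sup>2 - 4 * \<delta>)"
  define r1 where "r1 = (t + s) / 2"
  define r2 where "r2 = (t - s) / 2"
  have sum: "r1 + r2 = t" unfolding r1_def r2_def by (simp add: field_simps)
  have prod: "r1 * r2 = \<delta>"
  proof -
    have "r1 * r2 = (t\<^sup>2 - s\<^sup>2) / 4"
      unfolding r1_def r2_def by (simp add: field_simps power2_eq_square)
    then show ?thesis unfolding s_def by simp
  qed
  have factor: "det (mat z - cmat M) = (z - r1) * (z - r2)" for z
    unfolding char_poly_2 t_def[symmetric] \<delta>_def[symmetric] sum[symmetric] prod[symmetric]
    by (simp add: power2_eq_square algebra_simps)
  have "cmod r1 > 1" "cmod r2 > 1"
    using assms unfolding expanding_def factor by auto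
  then have "r1 \<noteq> 0" "r2 \<noteq> 0" "cmod (1 / r1) < 1" "cmod (1 / r2) < 1"
    by (auto simp: norm_divide divide_less_eq)
  moreover have "1 / r1 + 1 / r2 = t / \<delta>" "1 / r1 * (1 / r2) = 1 / \<delta>"
    using \<open>r1 \<noteq> 0\<close> \<open>r2 \<noteq> 0\<close> unfolding sum[symmetric] prod[symmetric] by (simp_all add: field_simps)
  ultimately show ?thesis
    by (intro that[of "1 / r1" "1 / r2"]) (simp_all add: t_def \<delta>_def)
qed

text \<open>A geometric sequence with ratio of modulus at most \<open>\<rho>\<close> is bounded by \<open>\<rho>\<^sup>n |v 0|\<close>.\<close>

lemma geometric_sequence_bound:
  fixes v :: "nat \<Rightarrow> 'a::real_normed_field" and \<rho> :: real
  assumes "\<And>n. v (Suc n) = \<mu> * v n" "norm \<mu> \<le> \<rho>"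
  shows "norm (v n) \<le> \<rho> ^ n * norm (v 0)"
proof (induction n)
  case (Suc n)
  have "norm (v (Suc n)) = norm \<mu> * norm (v n)" by (simp add: assms(1) norm_mult)
  also have "\<dots> \<le> \<rho> * (\<rho> ^ n * norm (v 0))"
    using Suc assms(2) order_trans[OF norm_ge_zero assms(2)] by (intro mult_mono) auto
  finally show ?case by simp
qed simp

text \<open>A scalar sequence obeying the recurrence with characteristic roots \<open>\<mu>\<^sub>1, \<mu>\<^sub>2\<close> of
  modulus at most \<open>\<rho>\<close> grows at most like \<open>(n + 1) \<rho>\<^sup>n\<close>; the first-order sequence
  \<open>u (n + 1) - \<mu>\<^sub>2 u n\<close> is geometric with ratio \<open>\<mu>\<^sub>1\<close>.\<close>

lemma linear_recurrence_bound:
  fixes u :: "nat \<Rightarrow> complex" and \<mu>1 \<mu>2 :: complex and \<rho> :: real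
  assumes rec: "\<And>n. u (Suc (Suc n)) = (\<mu>1 + \<mu>2) * u (Suc n) - \<mu>1 * \<mu>2 * u n"
    and "cmod \<mu>1 \<le> \<rho>" "cmod \<mu>2 \<le> \<rho>" "0 < \<rho>"
  shows "cmod (u n) \<le> (2 * cmod (u 0) + cmod (u 1) / \<rho>) * (Suc n * \<rho> ^ n)"
proof -
  define v where "v n = u (Suc n) - \<mu>2 * u n" for n
  have "v (Suc n) = \<mu>1 * v n" for n unfolding v_def using rec[of n] by (simp add: algebra_simps)
  then have v_bound: "cmod (v n) \<le> \<rho> ^ n * cmod (v 0)" for n
    using geometric_sequence_bound assms(2) by blast
  define a where "a = cmod (u 0)"
  define b where "b = cmod (v 0)"
  have "cmod (u n) \<le> (a + n * b / \<rho>) * \<rho> ^ n" for n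
  proof (induction n)
    case (Suc n)
    have "u (Suc n) = \<mu>2 * u n + v n" unfolding v_def by simp
    then have "cmod (u (Suc n)) \<le> cmod \<mu>2 * cmod (u n) + cmod (v n)"
      by (metis norm_mult norm_triangle_ineq)
    also have "\<dots> \<le> \<rho> * ((a + n * b / \<rho>) * \<rho> ^ n) + \<rho> ^ n * b"
      using Suc assms(3,4) v_bound[of n] unfolding b_def by (intro add_mono mult_mono) auto
    also have "\<dots> = (a + Suc n * b / \<rho>) * \<rho> ^ Suc n"
      using assms(4) by (simp add: field_simps)
    finally show ?case .
  qed (simp add: a_def)
  also have "(a + n * b / \<rho>) * \<rho> ^ n \<le> (a + b / \<rho>) * (Suc n * \<rho> ^ n)"
  proof -
    have "a + n * b / \<rho> \<le> Suc n * (a + b / \<rho>)"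
      using assms(4) unfolding a_def b_def by (simp add: field_simps mult_left_mono)
    then show ?thesis using assms(4) mult_right_mono[of _ _ "\<rho> ^ n"] by (simp add: mult_ac)
  qed
  also have "\<dots> \<le> (2 * cmod (u 0) + cmod (u 1) / \<rho>) * (Suc n * \<rho> ^ n)"
  proof (rule mult_right_mono)
    have "b \<le> cmod (u 1) + \<rho> * cmod (u 0)"
      using norm_triangle_ineq4[of "u 1" "\<mu>2 * u 0"] mult_right_mono[OF assms(3), of "cmod (u 0)"]
      unfolding b_def v_def by (simp add: norm_mult)
    then have "b / \<rho> \<le> (cmod (u 1) + \<rho> * cmod (u 0)) / \<rho>"
      using assms(4) by (simp add: divide_right_mono)
    also have "\<dots> = cmod (u 1) / \<rho> + cmod (u 0)"
      using assms(4) by (simp add: add_divide_distrib)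
    finally show "a + b / \<rho> \<le> 2 * cmod (u 0) + cmod (u 1) / \<rho>"
      unfolding a_def by linarith
  qed (use assms(4) in simp)
  finally show ?thesis .
qed

text \<open>By Cayley-Hamilton, the iterates of \<open>M\<^sup>-\<^sup>1\<close> satisfy a two-term linear recurrence.\<close>

lemma inverse_iterates_recurrence:
  fixes M :: "real^2^2" and x :: "real^2"
  assumes "det M \<noteq> 0"
  defines "y \<equiv> \<lambda>n. (((*v) (matrix_inv M)) ^^ n) x"
  shows "y (Suc (Suc n)) = ((M$1$1 + M$2$2) / det M) *\<^sub>R y (Suc n) - (1 / det M) *\<^sub>R y n"
proof -
  have inv: "invertible M" using assms(1) by (simp add: invertible_det_nz)
  have "y n = M *v (M *v y (Suc (Suc n)))"
    unfolding y_def by (simp add: matrix_inv_mult(1)[OF inv])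
  also have "\<dots> = (M$1$1 + M$2$2) *\<^sub>R y (Suc n) - det M *\<^sub>R y (Suc (Suc n))"
    unfolding cayley_hamilton_2 y_def by (simp add: matrix_inv_mult(1)[OF inv])
  finally have "det M *\<^sub>R y (Suc (Suc n)) = (M$1$1 + M$2$2) *\<^sub>R y (Suc n) - y n"
    by (simp add: algebra_simps)
  then have "(1 / det M) *\<^sub>R (det M *\<^sub>R y (Suc (Suc n)))
      = (1 / det M) *\<^sub>R ((M$1$1 + M$2$2) *\<^sub>R y (Suc n) - y n)" by simp
  then show ?thesis using assms(1) by (simp add: scaleR_diff_right)
qed

text \<open>For an expanding \<open>2 \<times> 2\<close> matrix each coordinate of \<open>M\<^sup>-\<^sup>n x\<close> is bounded by
  \<open>C \<parallel>x\<parallel> (n + 1) \<rho>\<^sup>n\<close> with \<open>\<rho> < 1\<close>: it obeys the recurrence of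
  \<open>inverse_iterates_recurrence\<close>, whose roots are the eigenvalues of \<open>M\<^sup>-\<^sup>1\<close>.\<close>

lemma expanding_inverse_coordinate_bound:
  fixes M :: "real^2^2"
  assumes "expanding M"
  obtains \<rho> C where "0 < \<rho>" "\<rho> < 1" "C \<ge> 0"
    "\<And>n x k. \<bar>((((*v) (matrix_inv M)) ^^ n) x) $ k\<bar> \<le> C * norm x * (real (Suc n) * \<rho> ^ n)"
proof -
  obtain \<mu>1 \<mu>2 where \<mu>: "cmod \<mu>1 < 1" "cmod \<mu>2 < 1" "\<mu>1 \<noteq> 0" "\<mu>2 \<noteq> 0"
    "\<mu>1 + \<mu>2 = complex_of_real ((M$1$1 + M$2$2) / det M)"
    "\<mu>1 * \<mu>2 = complex_of_real (1 / det M)"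
    using expanding_inverse_eigenvalues[OF assms] by blast
  define \<rho> where "\<rho> = max (cmod \<mu>1) (cmod \<mu>2)"
  have \<rho>: "0 < \<rho>" "\<rho> < 1" using \<mu>(1-4) unfolding \<rho>_def by (auto simp: less_max_iff_disj)
  obtain K where K: "K > 0" "\<And>x. norm (matrix_inv M *v x) \<le> norm x * K"
    using bounded_linear.pos_bounded[OF matrix_vector_mul_bounded_linear] by blast
  have "\<bar>((((*v) (matrix_inv M)) ^^ n) x) $ k\<bar> \<le> (2 + K / \<rho>) * norm x * (Suc n * \<rho> ^ n)"
    for n x k
  proof -
    define u where "u n = complex_of_real (((((*v) (matrix_inv M)) ^^ n) x) $ k)" for n
    have "u (Suc (Suc n)) = (\<mu>1 + \<mu>2) * u (Suc n) - \<mu>1 * \<mu>2 * u n" for n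
      using inverse_iterates_recurrence[OF expanding_det_nonzero[OF assms], where x=x and n=n]
      unfolding u_def \<mu>(5,6) by simp
    then have u_bound: "cmod (u n) \<le> (2 * cmod (u 0) + cmod (u 1) / \<rho>) * (Suc n * \<rho> ^ n)"
      by (rule linear_recurrence_bound) (use \<rho> in \<open>auto simp: \<rho>_def\<close>)
    have "cmod (u 0) \<le> norm x" "cmod (u 1) \<le> K * norm x"
      using component_le_norm_cart[of x k] component_le_norm_cart[of "matrix_inv M *v x" k] K(2)[of x]
      unfolding u_def by (simp_all add: mult.commute)
    then have "2 * cmod (u 0) + cmod (u 1) / \<rho> \<le> 2 * norm x + K * norm x / \<rho>"
      using \<rho>(1) by (simp add: add_mono divide_right_mono)
    also have "\<dots> = (2 + K / \<rho>) * norm x" using \<rho>(1) by (simp add: field_simps)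
    finally have "cmod (u n) \<le> (2 + K / \<rho>) * norm x * (Suc n * \<rho> ^ n)"
      using u_bound \<rho>(1) by (meson order_trans mult_right_mono zero_le_power less_imp_le
          mult_nonneg_nonneg of_nat_0_le_iff)
    then show ?thesis unfolding u_def by simp
  qed
  then show ?thesis using \<rho> K(1) by (intro that[of \<rho> "2 + K / \<rho>"]) auto
qed

text \<open>Summing the two coordinates: the iterates of \<open>M\<^sup>-\<^sup>1\<close> are bounded by the summable
  sequence \<open>2 C (n + 1) \<rho>\<^sup>n\<close>.\<close>

lemma expanding_inverse_decay:
  fixes M :: "real^2^2"
  assumes "expanding M"
  obtains bound where "summable bound" "\<And>n. bound n \<ge> 0"
    "\<And>n x. norm ((((*v) (matrix_inv M)) ^^ n) x) \<le> bound n * norm x"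
proof -
  obtain \<rho> C where \<rho>: "0 < \<rho>" "\<rho> < 1" and "C \<ge> 0" and coord:
    "\<And>n x k. \<bar>((((*v) (matrix_inv M)) ^^ n) x) $ k\<bar> \<le> C * norm x * (real (Suc n) * \<rho> ^ n)"
    using expanding_inverse_coordinate_bound[OF assms] by blast
  define bound where "bound n = 2 * C * (Suc n * \<rho> ^ n)" for n
  show ?thesis
  proof
    have "summable (\<lambda>n. of_nat (Suc n) * \<rho> ^ n)"
      using geometric_deriv_sums[of \<rho>] \<rho> by (auto simp: sums_iff)
    then show "summable bound" unfolding bound_def by (rule summable_mult)
    show "bound n \<ge> 0" for n unfolding bound_def using \<rho> \<open>C \<ge> 0\<close> by simp
  next
    fix n x
    let ?y = "(((*v) (matrix_inv M)) ^^ n) x"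
    have "norm ?y \<le> \<bar>?y $ 1\<bar> + \<bar>?y $ 2\<bar>"
      using norm_le_l1_cart[of ?y] by (simp add: sum_2)
    also have "\<dots> \<le> bound n * norm x"
      using coord[of n x 1] coord[of n x 2] unfolding bound_def by (simp add: field_simps)
    finally show "norm ?y \<le> bound n * norm x" .
  qed
qed

text \<open>Hence \<open>M\<^sup>-\<^sup>1\<close>, with any finite nonempty digit set, is a \<open>contractive_ifs\<close>.\<close>

lemma expanding_contractive_ifs:
  fixes M :: "real^2^2"
  assumes "expanding M" "finite D" "D \<noteq> {}"
  obtains bound where "contractive_ifs ((*v) (matrix_inv M)) bound D"
proof -
  have "invertible M" using expanding_det_nonzero[OF assms(1)] by (simp add: invertible_det_nz)
  then have "inj ((*v) (matrix_inv M))"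
    by (metis inj_on_inverseI matrix_inv_mult(1))
  moreover obtain bound where "summable bound" "\<And>n. bound n \<ge> 0"
    "\<And>n x. norm ((((*v) (matrix_inv M)) ^^ n) x) \<le> bound n * norm x"
    using expanding_inverse_decay[OF assms(1)] by blast
  ultimately show ?thesis
    using assms(2,3) matrix_vector_mul_linear
    by (intro that[of bound] contractive_ifs.intro) auto
qed

text \<open>Linear maps of \<open>\<real>\<^sup>2\<close> prescribed on a basis; \<open>cross2 a b\<close> is the determinant with
  columns \<open>a, b\<close>.\<close>

definition cross2 :: "real^2 \<Rightarrow> real^2 \<Rightarrow> real" where
  "cross2 a b = a$1 * b$2 - a$2 * b$1"

text \<open>Linearly independent vectors have nonzero determinant.\<close>

lemma cross2_nonzero:
  fixes v u :: "real^2"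
  assumes indep: "\<forall>a b::real. a *\<^sub>R v + b *\<^sub>R u = 0 \<longrightarrow> a = 0 \<and> b = 0"
  shows "cross2 v u \<noteq> 0"
proof
  assume "cross2 v u = 0"
  then have "(u$2) *\<^sub>R v + (- v$2) *\<^sub>R u = 0" "(u$1) *\<^sub>R v + (- v$1) *\<^sub>R u = 0"
    by (simp_all add: vec_eq_iff forall_2 cross2_def algebra_simps)
  then have "- v$1 = 0" "- v$2 = 0" using indep by blast+
  then have "1 *\<^sub>R v + 0 *\<^sub>R u = 0" by (simp add: vec_eq_iff forall_2)
  then show False using indep by auto
qed

text \<open>Cramer's rule: coordinates of a vector with respect to a basis \<open>v, u\<close> of \<open>\<real>\<^sup>2\<close>.\<close>

lemma basis_decomposition_2:
  fixes v u z :: "real^2" assumes "cross2 v u \<noteq> 0"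
  shows "z = (cross2 z u / cross2 v u) *\<^sub>R v + (cross2 v z / cross2 v u) *\<^sub>R u"
proof -
  have "cross2 z u * v$1 + cross2 v z * u$1 = z$1 * cross2 v u"
    "cross2 z u * v$2 + cross2 v z * u$2 = z$2 * cross2 v u"
    by (simp_all add: cross2_def algebra_simps)
  then have "cross2 z u / cross2 v u * v$1 + cross2 v z / cross2 v u * u$1 = z$1"
    "cross2 z u / cross2 v u * v$2 + cross2 v z / cross2 v u * u$2 = z$2"
    using assms by (simp_all add: field_simps)
  then show ?thesis by (simp add: vec_eq_iff forall_2)
qed

text \<open>Linear maps agreeing on a basis agree everywhere.\<close>

lemma linear_eq_on_basis_2:
  fixes v u :: "real^2" and F G :: "real^2 \<Rightarrow> real^2"
  assumes "cross2 v u \<noteq> 0" "linear F" "linear G" "F v = G v" "F u = G u"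
  shows "F z = G z"
proof -
  let ?a = "cross2 z u / cross2 v u" and ?b = "cross2 v z / cross2 v u"
  have "F z = F (?a *\<^sub>R v + ?b *\<^sub>R u)" using basis_decomposition_2[OF assms(1)] by simp
  also have "\<dots> = ?a *\<^sub>R G v + ?b *\<^sub>R G u" using assms(2,4,5) by (simp add: linear_add linear_cmul)
  also have "\<dots> = G (?a *\<^sub>R v + ?b *\<^sub>R u)" using assms(3) by (simp add: linear_add linear_cmul)
  also have "\<dots> = G z" using basis_decomposition_2[OF assms(1)] by simp
  finally show ?thesis .
qed

text \<open>The linear map of \<open>\<real>\<^sup>2\<close> sending the basis \<open>v, u\<close> to \<open>v', u'\<close>.\<close>

definition basis_map2 :: "real^2 \<Rightarrow> real^2 \<Rightarrow> real^2 \<Rightarrow> real^2 \<Rightarrow> real^2 \<Rightarrow> real^2" where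
  "basis_map2 v u v' u' z = (cross2 z u / cross2 v u) *\<^sub>R v' + (cross2 v z / cross2 v u) *\<^sub>R u'"

text \<open>Bilinearity of \<open>cross2\<close>, giving linearity of \<open>basis_map2\<close>.\<close>

lemma cross2_linear:
  "cross2 (x + y) u = cross2 x u + cross2 y u" "cross2 v (x + y) = cross2 v x + cross2 v y"
  "cross2 (r *\<^sub>R x) u = r * cross2 x u" "cross2 v (r *\<^sub>R x) = r * cross2 v x"
  by (simp_all add: cross2_def algebra_simps)

lemma basis_map2_linear: "linear (basis_map2 v u v' u')"
  by (rule linearI)
    (simp_all add: basis_map2_def cross2_linear add_divide_distrib scaleR_add_left scaleR_add_right)

lemma basis_map2_basis:
  assumes "cross2 v u \<noteq> 0"
  shows "basis_map2 v u v' u' v = v'" "basis_map2 v u v' u' u = u'"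
  using assms by (simp_all add: basis_map2_def cross2_def)

text \<open>The map sending \<open>v', u'\<close> back to \<open>v, u\<close> is the inverse of \<open>basis_map2 v u v' u'\<close>.\<close>

lemma basis_map2_inverse:
  assumes "cross2 v u \<noteq> 0" "cross2 v' u' \<noteq> 0"
  shows "basis_map2 v' u' v u (basis_map2 v u v' u' z) = z"
proof (rule linear_eq_on_basis_2[OF assms(1)])
  show "linear (\<lambda>z. basis_map2 v' u' v u (basis_map2 v u v' u' z))"
    using linear_compose[OF basis_map2_linear basis_map2_linear] by (simp add: o_def)
qed (simp_all add: assms basis_map2_basis linear_ident)

text \<open>Trace and determinant read off from the characteristic polynomial.\<close>

lemma char_poly_coefficients:
  fixes M :: "real^2^2"
  assumes "\<forall>x::real. det (mat x - M) = x\<^sup>2 + a * x + b"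
  shows "M$1$1 + M$2$2 = - a" "det M = b"
proof -
  have "det (mat x - M) = x\<^sup>2 - (M$1$1 + M$2$2) * x + det M" for x
    by (simp add: det_2 mat_def power2_eq_square algebra_simps)
  then have "x\<^sup>2 + a * x + b = x\<^sup>2 - (M$1$1 + M$2$2) * x + det M" for x
    using assms by simp
  from this[of 0] this[of 1] show "M$1$1 + M$2$2 = - a" "det M = b" by simp_all
qed

text \<open>If \<open>M'\<close> has the characteristic polynomial of \<open>-M\<close>, a linear map taking the cyclic
  basis \<open>v, M v\<close> to \<open>w, -M' w\<close> intertwines \<open>M\<close> with \<open>-M'\<close>: both sides agree on the
  basis by Cayley-Hamilton.\<close>

lemma anti_conjugacy_2:
  fixes M M' :: "real^2^2" and L :: "real^2 \<Rightarrow> real^2"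
  assumes "cross2 v (M *v v) \<noteq> 0" "linear L"
    and "M'$1$1 + M'$2$2 = - (M$1$1 + M$2$2)" "det M' = det M"
    and "L v = w" "L (M *v v) = - (M' *v w)"
  shows "L (M *v z) = - (M' *v L z)"
proof (rule linear_eq_on_basis_2[OF assms(1), where F = "\<lambda>z. L (M *v z)" and G = "\<lambda>z. - (M' *v L z)"])
  show "linear (\<lambda>z. L (M *v z))"
    using linear_compose[OF matrix_vector_mul_linear assms(2)] by (simp add: o_def)
  have "linear (\<lambda>z. M' *v L z)"
    using linear_compose[OF assms(2) matrix_vector_mul_linear] by (simp add: o_def)
  then show "linear (\<lambda>z. - (M' *v L z))" by (rule linear_compose_neg)
  show "L (M *v v) = - (M' *v L v)" using assms(5,6) by simp
  have "M' *v (M' *v w) = (M$1$1 + M$2$2) *\<^sub>R (- (M' *v w)) - det M *\<^sub>R w"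
    using cayley_hamilton_2[of M' w] assms(3,4) by (simp add: algebra_simps)
  have "L (M *v (M *v v)) = (M$1$1 + M$2$2) *\<^sub>R L (M *v v) - det M *\<^sub>R L v"
    unfolding cayley_hamilton_2 using assms(2) by (simp add: linear_diff linear_cmul)
  also have "\<dots> = M' *v (M' *v w)"
    using assms(5,6) \<open>M' *v (M' *v w) = _\<close> by simp
  also have "\<dots> = - (M' *v L (M *v v))"
    using assms(6) by (simp add: linear_neg[OF matrix_vector_mul_linear])
  finally show "L (M *v (M *v v)) = - (M' *v L (M *v v))" .
qed

text \<open>The intertwining relation passes to the inverse matrices.\<close>

lemma inverse_anti_conjugacy:
  fixes M M' :: "real^2^2" and L :: "real^2 \<Rightarrow> real^2"
  assumes "invertible M" "invertible M'" "linear L" "\<And>z. L (M *v z) = - (M' *v L z)"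
  shows "L (matrix_inv M *v z) = - (matrix_inv M' *v L z)"
proof -
  have "L z = - (M' *v L (matrix_inv M *v z))"
    using assms(4)[of "matrix_inv M *v z"] matrix_inv_mult(1)[OF assms(1)] by simp
  then have "matrix_inv M' *v L z = - L (matrix_inv M *v z)"
    by (simp add: linear_neg[OF matrix_vector_mul_linear] matrix_inv_mult(2)[OF assms(2)])
  then show ?thesis by simp
qed

text \<open>Hence, if \<open>B\<close> has the characteristic polynomial of \<open>-A\<close>, the self-affine set
  \<open>T(A, D)\<close> is linearly homeomorphic to the attractor of \<open>-B\<^sup>-\<^sup>1\<close> with digits \<open>L ` D\<close>, for
  the map \<open>L\<close> taking \<open>v, A v\<close> to \<open>w, -B w\<close>; its inverse takes \<open>w, -B w\<close> back to \<open>v, A v\<close>.\<close>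

lemma connected_self_affine_anti_conjugate:
  fixes A B :: "real^2^2" and v w :: "real^2"
  assumes "invertible A" "invertible B"
    and basis: "cross2 v (A *v v) \<noteq> 0" "cross2 w (B *v w) \<noteq> 0"
    and "B$1$1 + B$2$2 = - (A$1$1 + A$2$2)" "det B = det A"
  defines "L \<equiv> basis_map2 v (A *v v) w (- (B *v w))"
  shows "connected (self_affine A D) \<longleftrightarrow>
    connected (attractor (\<lambda>z. - (matrix_inv B *v z)) (L ` D))"
proof -
  define L' where "L' = basis_map2 w (- (B *v w)) v (A *v v)"
  have "linear L" "linear L'" unfolding L_def L'_def by (rule basis_map2_linear)+
  have intertwine: "L (A *v z) = - (B *v L z)" for z
    using anti_conjugacy_2[OF basis(1) \<open>linear L\<close>] assms(5,6) basis(1)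
    by (simp add: L_def basis_map2_basis)
  have conj: "L (matrix_inv A *v z) = - (matrix_inv B *v L z)" for z
    by (rule inverse_anti_conjugacy[OF assms(1,2) \<open>linear L\<close> intertwine])
  have "cross2 w (- (B *v w)) \<noteq> 0" using basis(2) by (simp add: cross2_def)
  then have "L' (L z) = z" "L (L' z) = z" for z
    unfolding L_def L'_def using basis(1) by (simp_all add: basis_map2_inverse)
  then show ?thesis
    unfolding self_affine_eq_attractor
    by (intro connected_attractor_conjugate[OF \<open>linear L\<close> \<open>linear L'\<close>] conj)
qed

text \<open>The main theorem: \<open>T(A, D)\<close> is connected iff \<open>T(B, D')\<close> is.  The map \<open>L\<close> above takes
  \<open>D\<close> onto \<open>D'\<close>, and \<open>T(-B\<^sup>-\<^sup>1, D')\<close> is connected iff \<open>T(B\<^sup>-\<^sup>1, D')\<close> is.\<close>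

theorem theorem3p4:
  fixes A B :: "real^2^2" and p q :: int and v w :: "real^2"
    and c d :: "nat \<Rightarrow> int"
  assumes "int_matrix A" and "int_matrix B"
    and "expanding A" and "expanding B"
    and "\<forall>x::real. det (mat x - A) = x^2 + of_int p * x + of_int q"
    and "\<forall>x::real. det (mat x - B) = x^2 - of_int p * x + of_int q"
    and "v \<noteq> 0" and "w \<noteq> 0"
    and "\<forall>a b::real. a *\<^sub>R v + b *\<^sub>R (A *v v) = 0 \<longrightarrow> a = 0 \<and> b = 0"
    and "\<forall>a b::real. a *\<^sub>R w + b *\<^sub>R (B *v w) = 0 \<longrightarrow> a = 0 \<and> b = 0"
    and "inj_on (\<lambda>i. of_int (c i) *\<^sub>R (A *v v) + of_int (d i) *\<^sub>R v) {0..<nat \<bar>q\<bar>}"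
  shows "connected (self_affine A ((\<lambda>i. of_int (c i) *\<^sub>R (A *v v) + of_int (d i) *\<^sub>R v) ` {0..<nat \<bar>q\<bar>}))
     \<longleftrightarrow> connected (self_affine B ((\<lambda>i. - of_int (c i) *\<^sub>R (B *v w) + of_int (d i) *\<^sub>R w) ` {0..<nat \<bar>q\<bar>}))"
proof -
  let ?DA = "(\<lambda>i. of_int (c i) *\<^sub>R (A *v v) + of_int (d i) *\<^sub>R v) ` {0..<nat \<bar>q\<bar>}"
  let ?DB = "(\<lambda>i. - of_int (c i) *\<^sub>R (B *v w) + of_int (d i) *\<^sub>R w) ` {0..<nat \<bar>q\<bar>}"
  let ?L = "basis_map2 v (A *v v) w (- (B *v w))"
  have A: "A$1$1 + A$2$2 = - of_int p" "det A = of_int q"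
    and B: "B$1$1 + B$2$2 = of_int p" "det B = of_int q"
    using char_poly_coefficients[of A] char_poly_coefficients[of B "- of_int p"] assms(5,6) by auto
  have "invertible A" "invertible B"
    using expanding_det_nonzero assms(3,4) by (auto simp: invertible_det_nz)
  have basis: "cross2 v (A *v v) \<noteq> 0" "cross2 w (B *v w) \<noteq> 0"
    using cross2_nonzero[OF assms(9)] cross2_nonzero[OF assms(10)] .
  have "?L (of_int (c i) *\<^sub>R (A *v v) + of_int (d i) *\<^sub>R v) = - of_int (c i) *\<^sub>R (B *v w) + of_int (d i) *\<^sub>R w" for i
    using basis_map2_linear basis(1) by (simp add: basis_map2_basis linear_add linear_cmul)
  then have "?L ` ?DA = ?DB" by (simp add: image_image)
  then have "connected (self_affine A ?DA) \<longleftrightarrow> connected (attractor (\<lambda>z. - (matrix_inv B *v z)) ?DB)"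
    using connected_self_affine_anti_conjugate[OF \<open>invertible A\<close> \<open>invertible B\<close> basis] A B by simp
  moreover have "q \<noteq> 0" using \<open>invertible A\<close> A(2) by (auto simp: invertible_det_nz)
  then obtain bound where "contractive_ifs ((*v) (matrix_inv B)) bound ?DB"
    using expanding_contractive_ifs[OF assms(4), of ?DB] by auto
  ultimately show ?thesis
    unfolding self_affine_eq_attractor
    using contractive_ifs.connected_attractor_neg by blast
qed

end
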